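(* Let $\eta$ be the real root of the polynomial $X^3+X^2+X-2$ (so $\eta\approx 0.811$), and set $\alpha=\log(2)/\log(2/\eta)\approx 0.767$. Then the growth $\gamma$ of Grigorchuk's group $G$ (the Grigorchuk $2$-group) satisfies $$e^{\sqrt{n}}\precsim\gamma(n)\precsim e^{n^\alpha}.$$
   Context: Throughout, $\mathbb{R}_+$ denotes the set of non-negative real numbers and $\mathbb{R}_+^*$ the set of positive real numbers. Grigorchuk $2$-group: let $\Sigma=\{0,1\}$, let $\Sigma^*$ be the set of finite sequences over $\Sigma$, and for $x\in\Sigma$ set $\overline{x}=1-x$. Define recursively the following length-preserving permutations $a,b,c,d$ of $\Sigma^*$, for $x\in\Sigma$, $\sigma\in\Sigma^*$: $a(x\sigma)=\overline{x}\sigma$; $b(0\sigma)=0a(\sigma)$, $b(1\sigma)=1c(\sigma)$; $c(0\sigma)=0a(\sigma)$, $c(1\sigma)=1d(\sigma)$; $d(0\sigma)=0\sigma$, $d(1\sigma)=1b(\sigma)$. The Grigorchuk $2$-group $G$ is the group generated by $\{a,b,c,d\}$. Growth: let $G$ be a group generated as a monoid by a finite set $S$. A weight on $(G,S)$ is a function $\omega:S\to\mathbb{R}_+^*$. It induces a length $\partial_\omega:G\to\mathbb{R}_+$, $\partial_\omega(g)=\min\{\omega(s_1)+\dots+\omega(s_k)\mid s_i\in S,\ s_1\cdots s_k=g \text{ in } G\}$. The growth of $G$ with respect to $\omega$ is $\gamma_\omega:\mathbb{R}_+\to\mathbb{R}_+$, $\gamma_\omega(n)=\#\{g\in G\mid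 \partial_\omega(g)\le n\}$. Domination: a function $\gamma:\mathbb{R}_+\to\mathbb{R}_+$ is dominated by $\delta:\mathbb{R}_+\to\mathbb{R}_+$, written $\gamma\precsim\delta$, if there is a constant $C\in\mathbb{R}_+$ such that $\gamma(n)\le\delta(Cn)$ for all $n\in\mathbb{R}_+$. Write $\gamma\sim\delta$ if $\gamma\precsim\delta$ and $\delta\precsim\gamma$. Different choices of finite generating set and weight give $\sim$-equivalent growth functions; "the growth" $\gamma$ of $G$ refers to any such function $\gamma_\omega$.
   Formalization: The lower bound is stated as: for every r>0 there is C with e^{√n} ≤ γ(Cn) for all real n ≥ r; domination for all n ≥ 0 fails, since γ(Cn)=1 < e^{√n} for small n>0. *)

theory Defs
  imports Complex_Main "HOL-Algebra.Bij" "HOL-Algebra.Generated_Groups"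
begin

section \<open>The Grigorchuk 2-group\<close>

text \<open>
  The alphabet \<open>{0,1}\<close> is represented by \<^typ>\<open>bool\<close>, with 0 as \<^const>\<open>False\<close> and 1 as \<^const>\<open>True\<close>.
  The empty word is fixed by all generators, since they preserve length.
\<close>

fun grig_a :: "bool list \<Rightarrow> bool list" where
  "grig_a [] = []"
| "grig_a (x # s) = (\<not> x) # s"

fun grig_b grig_c grig_d :: "bool list \<Rightarrow> bool list" where
  "grig_b [] = []"
| "grig_b (False # s) = False # grig_a s"
| "grig_b (True # s) = True # grig_c s"
| "grig_c [] = []"
| "grig_c (False # s) = False # grig_a s"
| "grig_c (True # s) = True # grig_d s"
| "grig_d [] = []"
| "grig_d (False # s) = False # s"
| "grig_d (True # s) = True # grig_b s"

definition grigorchuk_group :: "(bool list \<Rightarrow> bool list) monoid" where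
  "grigorchuk_group = subgroup_generated (BijGroup UNIV) {grig_a, grig_b, grig_c, grig_d}"

lemma grig_a_involution: "grig_a (grig_a s) = s"
  by (cases s) auto

lemma grig_bcd_involution:
  "grig_b (grig_b s) = s" "grig_c (grig_c s) = s" "grig_d (grig_d s) = s"
  by (induction s and s and s rule: grig_b_grig_c_grig_d.induct)
     (auto simp: grig_a_involution)

text \<open>\<^const>\<open>subgroup_generated\<close> discards generators outside the ambient group; here there are none.\<close>

lemma grig_generators_Bij: "{grig_a, grig_b, grig_c, grig_d} \<subseteq> carrier (BijGroup UNIV)"
proof -
  have "bij f" if "\<And>s. f (f s) = s" for f :: "bool list \<Rightarrow> bool list"
    using that by (intro o_bij[of f]) auto
  then show ?thesis
    by (auto simp: BijGroup_def Bij_def grig_a_involution grig_bcd_involution)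
qed


section \<open>Weighted word length and growth\<close>

definition word_prod :: "('a, 'b) monoid_scheme \<Rightarrow> 'a list \<Rightarrow> 'a" where
  "word_prod G ws = foldr (mult G) ws (one G)"

definition monoid_generating_set :: "('a, 'b) monoid_scheme \<Rightarrow> 'a set \<Rightarrow> bool" where
  "monoid_generating_set G S \<longleftrightarrow>
     S \<subseteq> carrier G \<and> (\<forall>g \<in> carrier G. \<exists>ws. set ws \<subseteq> S \<and> word_prod G ws = g)"

text \<open>
  The empty word is allowed, so the identity has length 0. The minimum exists
  under the hypotheses of \<open>weighted_length_attained\<close> below.
\<close>

definition weighted_length ::
    "('a, 'b) monoid_scheme \<Rightarrow> 'a set \<Rightarrow> ('a \<Rightarrow> real) \<Rightarrow> 'a \<Rightarrow> real" where
  "weighted_length G S \<omega> g =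
     (LEAST r. \<exists>ws. set ws \<subseteq> S \<and> word_prod G ws = g \<and> r = (\<Sum>s\<leftarrow>ws. \<omega> s))"

definition growth :: "('a, 'b) monoid_scheme \<Rightarrow> 'a set \<Rightarrow> ('a \<Rightarrow> real) \<Rightarrow> real \<Rightarrow> real" where
  "growth G S \<omega> n = real (card {g \<in> carrier G. weighted_length G S \<omega> g \<le> n})"

lemma length_le_weight:
  assumes "\<And>s. s \<in> S \<Longrightarrow> (w::real) \<le> \<omega> s" "set ws \<subseteq> S"
  shows "real (length ws) * w \<le> (\<Sum>s\<leftarrow>ws. \<omega> s)"
  using assms(2)
proof (induction ws)
  case (Cons s ws)
  then show ?case using assms(1)[of s] by (simp add: algebra_simps)
qed simp

lemma weights_bounded_below:
  fixes \<omega> :: "'a \<Rightarrow> real"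
  assumes "finite S" "\<And>s. s \<in> S \<Longrightarrow> \<omega> s > 0"
  obtains w where "w > 0" "\<And>s. s \<in> S \<Longrightarrow> w \<le> \<omega> s"
proof
  show "Min (insert 1 (\<omega> ` S)) > 0" using assms by (auto simp: Min_gr_iff)
  show "Min (insert 1 (\<omega> ` S)) \<le> \<omega> s" if "s \<in> S" for s using assms that by (auto intro: Min_le)
qed

lemma weighted_length_attained:
  assumes "finite S" "\<And>s. s \<in> S \<Longrightarrow> \<omega> s > 0"
    and gen: "monoid_generating_set G S" and g: "g \<in> carrier G"
  obtains ws where "set ws \<subseteq> S" "word_prod G ws = g" "weighted_length G S \<omega> g = (\<Sum>s\<leftarrow>ws. \<omega> s)"
    "\<And>vs. set vs \<subseteq> S \<Longrightarrow> word_prod G vs = g \<Longrightarrow> (\<Sum>s\<leftarrow>ws. \<omega> s) \<le> (\<Sum>s\<leftarrow>vs. \<omega> s)"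
proof -
  obtain w where w: "w > 0" "\<And>s. s \<in> S \<Longrightarrow> w \<le> \<omega> s"
    using weights_bounded_below[of S \<omega>] assms by metis
  obtain us where us: "set us \<subseteq> S" "word_prod G us = g"
    using gen g by (auto simp: monoid_generating_set_def)
  let ?f = "\<lambda>vs. (\<Sum>s\<leftarrow>vs. \<omega> s)"
  define B where "B = {vs. set vs \<subseteq> S \<and> word_prod G vs = g \<and> ?f vs \<le> ?f us}"
  have "B \<subseteq> {vs. set vs \<subseteq> S \<and> length vs \<le> nat \<lceil>?f us / w\<rceil>}"
  proof
    fix vs assume vs: "vs \<in> B"
    then have "real (length vs) * w \<le> ?f us"
      using length_le_weight[of S w \<omega> vs] w by (force simp: B_def)
    then have "real (length vs) \<le> ?f us / w" using w by (simp add: field_simps)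
    then have "length vs \<le> nat \<lceil>?f us / w\<rceil>" by linarith
    then show "vs \<in> {vs. set vs \<subseteq> S \<and> length vs \<le> nat \<lceil>?f us / w\<rceil>}"
      using vs by (auto simp: B_def)
  qed
  then have "finite B" using finite_lists_length_le[OF \<open>finite S\<close>] finite_subset by blast
  moreover have "us \<in> B" using us by (auto simp: B_def)
  ultimately obtain ws where ws: "ws \<in> B" "\<And>vs. vs \<in> B \<Longrightarrow> ?f ws \<le> ?f vs"
    using arg_min_if_finite(1)[of B ?f] arg_min_least[of B _ ?f] by blast
  have min: "?f ws \<le> ?f vs" if "set vs \<subseteq> S" "word_prod G vs = g" for vs
  proof (cases "vs \<in> B")
    case False
    then have "?f us \<le> ?f vs" using that by (auto simp: B_def)
    then show ?thesis using ws \<open>us \<in> B\<close> by fastforce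
  qed (use ws in auto)
  have "weighted_length G S \<omega> g = ?f ws"
    unfolding weighted_length_def
    by (rule Least_equality) (use ws min in \<open>auto simp: B_def\<close>)
  with ws min show ?thesis by (intro that[of ws]) (auto simp: B_def)
qed


section \<open>Domination\<close>

text \<open>
  Domination of functions on the non-negative reals is the case \<open>r = 0\<close>. It cannot be used
  verbatim with \<open>e\<close> to the power \<open>sqrt n\<close> on the left and a growth function on the right: the latter
  equals 1 on a neighbourhood of 0 (lemma \<open>not_dominated_exp_sqrt_growth\<close> below). Such
  a lower bound is therefore asserted from every threshold \<open>r > 0\<close> on, with \<open>C\<close> depending on \<open>r\<close>.
  As both functions are non-decreasing, one value of \<open>r\<close> implies all others, by rescaling \<open>C\<close>.
\<close>

definition dominated_from :: "real \<Rightarrow> (real \<Rightarrow> real) \<Rightarrow> (real \<Rightarrow> real) \<Rightarrow> bool" where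
  "dominated_from r \<gamma> \<delta> \<longleftrightarrow> (\<exists>C\<ge>0. \<forall>n\<ge>r. \<gamma> n \<le> \<delta> (C * n))"

abbreviation dominated :: "(real \<Rightarrow> real) \<Rightarrow> (real \<Rightarrow> real) \<Rightarrow> bool" where
  "dominated \<equiv> dominated_from 0"

lemma not_dominated_exp_sqrt_growth:
  assumes "finite S" "\<And>s. s \<in> S \<Longrightarrow> \<omega> s > 0" and gen: "monoid_generating_set G S"
  shows "\<not> dominated (\<lambda>n. exp (sqrt n)) (growth G S \<omega>)"
proof
  assume "dominated (\<lambda>n. exp (sqrt n)) (growth G S \<omega>)"
  then obtain C where C: "C \<ge> 0" "\<And>n. n \<ge> 0 \<Longrightarrow> exp (sqrt n) \<le> growth G S \<omega> (C * n)"
    by (auto simp: dominated_from_def)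
  obtain w where w: "w > 0" "\<And>s. s \<in> S \<Longrightarrow> w \<le> \<omega> s"
    using weights_bounded_below[of S \<omega>] assms by metis
  define n where "n = w / (C + 1)"
  have n: "n > 0" "C * n < w" using C w by (auto simp: n_def field_simps)
  have "{g \<in> carrier G. weighted_length G S \<omega> g \<le> C * n} \<subseteq> {one G}"
  proof safe
    fix g assume g: "g \<in> carrier G" "weighted_length G S \<omega> g \<le> C * n"
    obtain ws where ws: "set ws \<subseteq> S" "word_prod G ws = g"
        "weighted_length G S \<omega> g = (\<Sum>s\<leftarrow>ws. \<omega> s)"
      using weighted_length_attained[of S \<omega> G g] assms g by metis
    have "real (length ws) * w < 1 * w"
      using length_le_weight[of S w \<omega> ws, OF w(2) ws(1)] ws(3) g(2) n(2) by linarith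
    then have "ws = []" using w by (cases ws) (auto simp: mult_less_cancel_right)
    then show "g = one G" using ws by (simp add: word_prod_def)
  qed
  then have "card {g \<in> carrier G. weighted_length G S \<omega> g \<le> C * n} \<le> card {one G}"
    by (intro card_mono) auto
  then have "growth G S \<omega> (C * n) \<le> 1" by (simp add: growth_def)
  moreover have "exp (sqrt n) > 1" using n by simp
  ultimately show False using C(2)[of n] n by linarith
qed


section \<open>The exponent\<close>

definition grig_eta :: real where
  "grig_eta = (THE x. x ^ 3 + x ^ 2 + x - 2 = 0)"

definition grig_alpha :: real where
  "grig_alpha = ln 2 / ln (2 / grig_eta)"

end

theory Submission
  imports Defs "HOL-Analysis.Convex"
begin

text \<open>
  Every element \<open>g\<close> is determined by its action on the first letter and its two sections. For
  weights of \<open>a, b, c, d\<close> adapted to \<open>\<eta>\<close>, the weights of the sections add up to at most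
  \<open>\<eta>\<close> times that of \<open>g\<close>, up to a constant. Iterating until all weights are
  bounded yields a binary tree whose number of leaves is \<open>O(n powr \<alpha>)\<close>, because
  \<open>2 (\<eta>/2) powr \<alpha> = 1\<close> and \<open>x powr \<alpha>\<close> is concave; and there are only exponentially many trees
  with a given number of leaves.

  Conversely, pairs of elements of length \<open>n\<close> are, up to finite ambiguity, the sections of elements
  of length about \<open>4 n\<close>, so the growth \<open>\<gamma>\<close> satisfies \<open>\<gamma>(4 n + 2) \<ge> \<gamma>(n)\<^sup>2 / 64\<close>; once
  \<open>\<gamma>\<close> exceeds 64 this forces growth at least \<open>exp (c sqrt n)\<close>.
\<close>

section \<open>Words and sections\<close>

datatype letter = A | B | C | D

fun act :: "letter \<Rightarrow> bool list \<Rightarrow> bool list" where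
  "act A = grig_a"
| "act B = grig_b"
| "act C = grig_c"
| "act D = grig_d"

lemma act_involution [simp]: "act l (act l s) = s"
  by (cases l) (simp_all add: grig_a_involution grig_bcd_involution)

lemma act_Nil [simp]: "act l [] = []"
  by (cases l) simp_all

fun eval :: "letter list \<Rightarrow> bool list \<Rightarrow> bool list" where
  "eval [] s = s"
| "eval (l # ws) s = act l (eval ws s)"

lemma eval_append: "eval (us @ vs) s = eval us (eval vs s)"
  by (induction us) simp_all

lemma eval_Nil [simp]: "eval ws [] = []"
  by (induction ws) simp_all

lemma bij_eval: "bij (eval ws)"
proof (induction ws)
  case (Cons l ws)
  have "bij (act l)" by (rule o_bij[of "act l"]) auto
  with Cons have "bij (act l \<circ> eval ws)" by (rule bij_comp)
  moreover have "act l \<circ> eval ws = eval (l # ws)" by auto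
  ultimately show ?case by (rule subst[where P = bij, rotated])
next
  case Nil
  have "id = eval []" by auto
  with bij_id show ?case by (rule subst[where P = bij, rotated])
qed

text \<open>Multiplication in the Klein four-group of 1, \<open>b\<close>, \<open>c\<close>,
  \<open>d\<close>; the value \<open>A\<close> in the last clause is a dummy.\<close>

fun third :: "letter \<Rightarrow> letter \<Rightarrow> letter" where
  "third B C = D" | "third C B = D"
| "third B D = C" | "third D B = C"
| "third C D = B" | "third D C = B"
| "third x y = A"

text \<open>The six relations go through one induction because below the letter 1 they are permuted
  cyclically (\<open>b\<close>, \<open>c\<close>, \<open>d\<close> act there as \<open>c\<close>,
  \<open>d\<close>, \<open>b\<close>), while below 0 it is enough that \<open>a\<close> is an
  involution.\<close>

lemma grig_bcd_products:
  "grig_b (grig_c s) = grig_d s" "grig_c (grig_b s) = grig_d s"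
  "grig_b (grig_d s) = grig_c s" "grig_d (grig_b s) = grig_c s"
  "grig_c (grig_d s) = grig_b s" "grig_d (grig_c s) = grig_b s"
proof (induction s)
  case (Cons x s)
  { case 1 show ?case using Cons by (cases x) (simp_all add: grig_a_involution)
  next case 2 show ?case using Cons by (cases x) (simp_all add: grig_a_involution)
  next case 3 show ?case using Cons by (cases x) (simp_all add: grig_a_involution)
  next case 4 show ?case using Cons by (cases x) (simp_all add: grig_a_involution)
  next case 5 show ?case using Cons by (cases x) (simp_all add: grig_a_involution)
  next case 6 show ?case using Cons by (cases x) (simp_all add: grig_a_involution) }
qed simp_all

lemma act_third:
  "x \<noteq> A \<Longrightarrow> y \<noteq> A \<Longrightarrow> x \<noteq> y \<Longrightarrow> act x (act y s) = act (third x y) s"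
  by (cases x; cases y) (simp_all add: grig_bcd_products)

lemma third_neq_A: "x \<noteq> A \<Longrightarrow> y \<noteq> A \<Longrightarrow> x \<noteq> y \<Longrightarrow> third x y \<noteq> A"
  by (cases x; cases y) simp_all

abbreviation alternating :: "letter list \<Rightarrow> bool" where
  "alternating \<equiv> successively (\<lambda>x y. (x = A) \<noteq> (y = A))"

text \<open>The second condition makes fusing two distinct neighbours among \<open>b\<close>,
  \<open>c\<close>, \<open>d\<close> into their product harmless for the weight.\<close>

definition triangular :: "(letter \<Rightarrow> real) \<Rightarrow> bool" where
  "triangular f \<longleftrightarrow> (\<forall>l. 0 \<le> f l) \<and>
     (\<forall>x y. x \<noteq> A \<longrightarrow> y \<noteq> A \<longrightarrow> x \<noteq> y \<longrightarrow> f (third x y) \<le> f x + f y)"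

lemma triangularI:
  assumes "\<And>l. 0 \<le> f l" "f B \<le> f C + f D" "f C \<le> f B + f D" "f D \<le> f B + f C"
  shows "triangular f"
  unfolding triangular_def
proof (intro conjI allI impI assms(1))
  show "f (third x y) \<le> f x + f y" if "x \<noteq> A" "y \<noteq> A" "x \<noteq> y" for x y
    using that assms by (cases x; cases y) simp_all
qed

text \<open>Letters are put in front of an alternating word one at a time: equal neighbours cancel,
  distinct ones among \<open>b\<close>, \<open>c\<close>, \<open>d\<close> fuse into the third, and
  neither move raises a triangular weight.\<close>

lemma alternating_reduction:
  assumes "triangular f"
  obtains vs where "alternating vs" "eval vs = eval ws" "(\<Sum>l\<leftarrow>vs. f l) \<le> (\<Sum>l\<leftarrow>ws. f l)"
proof -
  have pos: "0 \<le> f l" for l using assms by (simp add: triangular_def)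
  have "\<exists>vs. alternating vs \<and> (\<forall>s. eval vs s = eval ws s) \<and> (\<Sum>l\<leftarrow>vs. f l) \<le> (\<Sum>l\<leftarrow>ws. f l)"
  proof (induction ws)
    case Nil
    show ?case by (intro exI[of _ "[]"]) simp
  next
    case (Cons l ws)
    then obtain vs where vs: "alternating vs" "\<And>s. eval vs s = eval ws s"
      "(\<Sum>l\<leftarrow>vs. f l) \<le> (\<Sum>l\<leftarrow>ws. f l)" by blast
    show ?case
    proof (cases "alternating (l # vs)")
      case True
      then show ?thesis using vs by (intro exI[of _ "l # vs"]) simp
    next
      case False
      then obtain k us where vs_eq: "vs = k # us" and same: "(l = A) = (k = A)"
        using vs(1) by (cases vs) auto
      show ?thesis
      proof (cases "l = k")
        case True
        have "eval us s = eval (l # ws) s" for s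
          using vs(2)[of s] vs_eq True by (simp flip: vs(2))
        moreover have "alternating us" using vs(1) vs_eq by (cases us) auto
        ultimately show ?thesis using vs(3) vs_eq pos[of k] pos[of l]
          by (intro exI[of _ us]) auto
      next
        case neq: False
        with same have nA: "l \<noteq> A" "k \<noteq> A" by auto
        have "f (third l k) \<le> f l + f k" using assms nA neq by (auto simp: triangular_def)
        moreover have "alternating (third l k # us)"
          using vs(1) vs_eq nA third_neq_A[OF nA neq] by (cases us) auto
        moreover have "eval (third l k # us) s = eval (l # ws) s" for s
          using act_third[OF nA neq, of "eval us s"] by (simp add: vs_eq flip: vs(2))
        ultimately show ?thesis using vs(3) vs_eq
          by (intro exI[of _ "third l k # us"]) auto
      qed
    qed
  qed
  then show ?thesis using that by (metis ext)
qed

section \<open>Sections of words at the first letter\<close>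

fun parity :: "letter list \<Rightarrow> bool" where
  "parity [] = False"
| "parity (l # ws) = ((l = A) \<noteq> parity ws)"

fun letter_section :: "bool \<Rightarrow> letter \<Rightarrow> letter list" where
  "letter_section x A = []"
| "letter_section x B = (if x then [C] else [A])"
| "letter_section x C = (if x then [D] else [A])"
| "letter_section x D = (if x then [B] else [])"

text \<open>The suffix \<open>ws\<close> acts first and turns the first letter \<open>x\<close> into
  \<open>x \<noteq> parity ws\<close>, so that is where the section of \<open>l\<close> has to be
  taken.\<close>

fun word_section :: "bool \<Rightarrow> letter list \<Rightarrow> letter list" where
  "word_section x [] = []"
| "word_section x (l # ws) = letter_section (x \<noteq> parity ws) l @ word_section x ws"

lemma act_Cons: "act l (x # s) = (x \<noteq> (l = A)) # eval (letter_section x l) s"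
  by (cases l; cases x) simp_all

lemma eval_Cons: "eval ws (x # s) = (x \<noteq> parity ws) # eval (word_section x ws) s"
  by (induction ws) (auto simp: act_Cons eval_append)

lemma count_alternating:
  assumes "alternating ws"
  shows "length (filter (\<lambda>l. l = A) ws) \<le> length (filter (\<lambda>l. l \<noteq> A) ws) + 1"
    and "length (filter (\<lambda>l. l \<noteq> A) ws) \<le> length (filter (\<lambda>l. l = A) ws) + 1"
proof -
  let ?m = "\<lambda>ws. length (filter (\<lambda>l. l = A) ws)" and ?n = "\<lambda>ws. length (filter (\<lambda>l. l \<noteq> A) ws)"
  \<comment> \<open>The induction needs to know which kind of letter can be in excess, and this is
    decided by the head of the word.\<close>
  have "?m ws \<le> ?n ws + 1 \<and> ?n ws \<le> ?m ws + 1 \<and> (ws \<noteq> [] \<longrightarrow> hd ws = A \<longrightarrow> ?n ws \<le> ?m ws)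
    \<and> (ws \<noteq> [] \<longrightarrow> hd ws \<noteq> A \<longrightarrow> ?m ws \<le> ?n ws)" using assms
  proof (induction ws)
    case (Cons l ws)
    then show ?case by (cases ws) (auto split: if_splits)
  qed simp
  then show "?m ws \<le> ?n ws + 1" "?n ws \<le> ?m ws + 1" by auto
qed


section \<open>The contracting weight\<close>

lemma grig_eta_root: "grig_eta ^ 3 + grig_eta ^ 2 + grig_eta - 2 = 0"
  and grig_eta_bounds: "1/2 < grig_eta" "grig_eta < 1"
proof -
  let ?p = "\<lambda>x::real. x ^ 3 + x ^ 2 + x - 2"
  have "\<exists>x. 1/2 \<le> x \<and> x \<le> 1 \<and> ?p x = 0"
    by (rule IVT') (auto intro!: continuous_intros simp: power3_eq_cube power2_eq_square)
  then obtain x where x: "1/2 \<le> x" "x \<le> 1" "?p x = 0" by blast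
  have uniq: "y = x" if "?p y = 0" for y
  proof (rule ccontr)
    assume "y \<noteq> x"
    \<comment> \<open>Twice the difference quotient of the cubic is a sum of squares, and
      \<open>(x + 1)\<^sup>2\<close> is positive; hence the root is unique.\<close>
    have "(x - y) * ((x + y)\<^sup>2 + (x + 1)\<^sup>2 + (y + 1)\<^sup>2) = 2 * (?p x - ?p y)"
      by (simp add: power3_eq_cube power2_eq_square algebra_simps)
    then have "(x + y)\<^sup>2 + (x + 1)\<^sup>2 + (y + 1)\<^sup>2 = 0" using x(3) that \<open>y \<noteq> x\<close> by simp
    moreover have "(x + 1)\<^sup>2 > 0" using x by (intro zero_less_power) auto
    ultimately show False using zero_le_power2[of "x + y"] zero_le_power2[of "y + 1"] by linarith
  qed
  have eq: "grig_eta = x" unfolding grig_eta_def using x(3) uniq by (rule the_equality)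
  have "?p (1/2) \<noteq> 0" "?p 1 \<noteq> 0" by (simp_all add: power_divide)
  then have "x \<noteq> 1/2" "x \<noteq> 1" using x(3) by metis+
  then show "?p grig_eta = 0" "1/2 < grig_eta" "grig_eta < 1" using x eq by auto
qed

text \<open>Normalised so that the weights of \<open>ab\<close>, \<open>ac\<close>,
  \<open>ad\<close>, \<open>b\<close> are 1, \<open>\<eta>\<close>, \<open>\<eta>\<^sup>2\<close>,
  \<open>\<eta>\<^sup>3\<close>. The sections of \<open>b\<close>, \<open>c\<close>,
  \<open>d\<close> are \<open>a\<close> and \<open>c\<close>, \<open>a\<close> and \<open>d\<close>,
  1 and \<open>b\<close>, so taking sections moves one place along this geometric sequence.\<close>

fun cweight :: "letter \<Rightarrow> real" where
  "cweight A = 1 - grig_eta ^ 3"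
| "cweight B = grig_eta ^ 3"
| "cweight C = 1 - grig_eta ^ 2"
| "cweight D = 1 - grig_eta"

lemma cweight_pos: "0 < cweight l"
proof -
  have "grig_eta ^ 3 < 1" "grig_eta ^ 2 < 1"
    using grig_eta_bounds by (auto intro!: power_less_one_iff[THEN iffD2])
  then show ?thesis using grig_eta_bounds by (cases l) auto
qed

lemma cweight_A_less: "cweight A < 1"
  using grig_eta_bounds by simp

lemma triangular_cweight: "triangular cweight"
proof (rule triangularI)
  show "0 \<le> cweight l" for l using cweight_pos[of l] by simp
  have "cweight B = cweight C + cweight D" using grig_eta_root by simp
  with cweight_pos[of C] cweight_pos[of D]
  show "cweight B \<le> cweight C + cweight D" "cweight C \<le> cweight B + cweight D"
    "cweight D \<le> cweight B + cweight C" by linarith+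
qed

abbreviation cw :: "letter list \<Rightarrow> real" where
  "cw ws \<equiv> (\<Sum>l\<leftarrow>ws. cweight l)"

lemma cw_nonneg: "0 \<le> cw ws"
  by (induction ws) (use cweight_pos less_imp_le in \<open>auto intro!: add_nonneg_nonneg\<close>)

text \<open>The weight is chosen so that the two sections of \<open>l \<in> {b,c,d}\<close> weigh together \<open>\<eta>\<close> times
  \<open>l\<close> and one letter \<open>a\<close>.\<close>

lemma cw_letter_section:
  "cw (letter_section x l) + cw (letter_section (\<not> x) l) =
     (if l = A then 0 else grig_eta * (cweight A + cweight l))"
proof -
  have e3: "grig_eta * (grig_eta * grig_eta) = 2 - grig_eta - grig_eta * grig_eta"
    using grig_eta_root by (simp add: power3_eq_cube power2_eq_square)
  \<comment> \<open>The cubic and its multiple by \<open>\<eta>\<close> eliminate third and fourth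
    powers, which settles every case.\<close>
  have "grig_eta * (grig_eta * (grig_eta * grig_eta)) = 3 * grig_eta - 2"
    unfolding e3 using e3 by (simp add: algebra_simps)
  with e3 show ?thesis
    by (cases l; cases x) (auto simp: power3_eq_cube power2_eq_square algebra_simps)
qed

text \<open>By \<open>cw_letter_section\<close> each letter other than \<open>A\<close> pays for
  itself and for one \<open>A\<close>. An alternating word has at most one \<open>A\<close> too few
  for this, whence the extra \<open>cweight A\<close>.\<close>

lemma cw_sections:
  assumes "alternating ws"
  shows "cw (word_section False ws) + cw (word_section True ws) \<le> grig_eta * (cw ws + cweight A)"
proof -
  have *: "cw (word_section False ws) + cw (word_section True ws) =
     grig_eta * (cw ws + cweight A * (real (length (filter (\<lambda>l. l \<noteq> A) ws))
        - real (length (filter (\<lambda>l. l = A) ws))))" for ws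
  proof (induction ws)
    case (Cons l ws)
    have "cw (word_section False (l # ws)) + cw (word_section True (l # ws)) =
      cw (letter_section (parity ws) l) + cw (letter_section (\<not> parity ws) l)
      + (cw (word_section False ws) + cw (word_section True ws))"
      by simp
    also have "\<dots> = grig_eta * (cw (l # ws) + cweight A * (real (length (filter (\<lambda>l. l \<noteq> A) (l # ws)))
        - real (length (filter (\<lambda>l. l = A) (l # ws)))))"
      unfolding cw_letter_section Cons by (cases "l = A") (simp_all add: algebra_simps)
    finally show ?case .
  qed simp
  have "cweight A * (real (length (filter (\<lambda>l. l \<noteq> A) ws)) - real (length (filter (\<lambda>l. l = A) ws)))
     \<le> cweight A * 1"
    using count_alternating(2)[OF assms] cweight_pos[of A] by (intro mult_left_mono) auto
  then show ?thesis unfolding * using grig_eta_bounds by (intro mult_left_mono) auto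
qed


section \<open>The upper bound\<close>

text \<open>\<open>grig_alpha_eq\<close> makes \<open>\<alpha>\<close> the critical exponent: when a
  quantity shrinks by the factor \<open>\<eta>\<close> and is cut into halves, the sum of the powers
  with exponent \<open>\<alpha>\<close> is unchanged.\<close>

lemma grig_alpha_bounds: "0 < grig_alpha" "grig_alpha < 1"
  and grig_alpha_eq: "2 * (grig_eta / 2) powr grig_alpha = 1"
proof -
  have l: "ln 2 < ln (2 / grig_eta)"
    using grig_eta_bounds by (subst ln_less_cancel_iff) (auto simp: field_simps)
  have l2: "0 < ln (2::real)" by simp
  then have "0 < ln (2 / grig_eta)" using l by linarith
  then show "0 < grig_alpha" "grig_alpha < 1"
    unfolding grig_alpha_def using l l2 by (simp_all only: divide_pos_pos divide_less_eq_1_pos)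
  have "ln (grig_eta / 2) = - ln (2 / grig_eta)" using grig_eta_bounds by (simp add: ln_div)
  moreover have "0 < ln (2 / grig_eta)" using l l2 by linarith
  ultimately have "grig_alpha * ln (grig_eta / 2) = - ln 2"
    by (simp add: grig_alpha_def)
  then have "(grig_eta / 2) powr grig_alpha = exp (- ln 2)"
    using grig_eta_bounds by (simp add: powr_def)
  then show "2 * (grig_eta / 2) powr grig_alpha = 1" by (simp add: exp_minus)
qed

text \<open>Midpoint concavity. Both arguments are divided by their mean and bounded by the tangent
  line at 1, an instance of Young's inequality; the two tangent values add up to 2.\<close>

lemma powr_add_le:
  fixes x y \<alpha> :: real
  assumes "0 < x" "0 < y" "0 \<le> \<alpha>" "\<alpha> \<le> 1"
  shows "x powr \<alpha> + y powr \<alpha> \<le> 2 * ((x + y) / 2) powr \<alpha>"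
proof -
  define m where "m = (x + y) / 2"
  have m: "0 < m" using assms by (simp add: m_def)
  have tangent: "t powr \<alpha> \<le> \<alpha> * t + (1 - \<alpha>)" if "0 < t" for t
    using Youngs_inequality_0[of \<alpha> "1 - \<alpha>" t 1] assms that by simp
  have split: "z powr \<alpha> = m powr \<alpha> * (z / m) powr \<alpha>" if "0 < z" for z
    using that m by (simp flip: powr_mult)
  have "x powr \<alpha> + y powr \<alpha> = m powr \<alpha> * ((x / m) powr \<alpha> + (y / m) powr \<alpha>)"
    using split[OF assms(1)] split[OF assms(2)] by (simp add: distrib_left)
  also have "\<dots> \<le> m powr \<alpha> * (\<alpha> * (x / m) + (1 - \<alpha>) + (\<alpha> * (y / m) + (1 - \<alpha>)))"
    using tangent[of "x / m"] tangent[of "y / m"] assms m by (intro mult_left_mono add_mono) auto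
  also have "\<alpha> * (x / m) + (1 - \<alpha>) + (\<alpha> * (y / m) + (1 - \<alpha>)) = 2"
  proof -
    have "\<alpha> * (x / m) + \<alpha> * (y / m) = \<alpha> * ((x + y) / m)"
      by (simp add: add_divide_distrib distrib_left)
    also have "(x + y) / m = 2" using m by (simp add: m_def field_simps)
    finally show ?thesis by simp
  qed
  finally show ?thesis by (simp add: m_def)
qed

section \<open>Counting the leaves of the tree of sections\<close>

definition cutoff :: real where
  "cutoff = 6 / (1 - grig_eta)"

text \<open>The shift turns \<open>l0 + l1 \<le> \<eta> (l + \<omega> a)\<close> into \<open>m0 + m1 \<le> \<eta> m\<close> for \<open>m = l - shift\<close>.\<close>

definition shift :: real where
  "shift = grig_eta * cweight A / (2 - grig_eta)"

lemma shift_bounds: "0 < shift" "shift < 1"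
  and shift_eq: "grig_eta * cweight A - 2 * shift = - grig_eta * shift"
proof -
  have c: "0 < cweight A" "cweight A < 1" by (rule cweight_pos, rule cweight_A_less)
  have "grig_eta * cweight A < grig_eta * 1"
    using grig_eta_bounds c by (intro mult_strict_left_mono) auto
  then have "grig_eta * cweight A < 2 - grig_eta" using grig_eta_bounds by linarith
  then show "0 < shift" "shift < 1" using grig_eta_bounds c
    by (auto simp: shift_def simp del: cweight.simps)
  show "grig_eta * cweight A - 2 * shift = - grig_eta * shift"
    using grig_eta_bounds by (simp add: shift_def field_simps del: cweight.simps)
qed

lemma cutoff_ge: "6 \<le> cutoff"
  using grig_eta_bounds by (simp add: cutoff_def field_simps)

text \<open>Iterating sections until their weight is at most the cutoff represents an element of weight
  \<open>l\<close> by a binary tree; this bounds its number of leaves.\<close>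

definition leaf_bound :: "real \<Rightarrow> real \<Rightarrow> real" where
  "leaf_bound a l = (if l \<le> cutoff then 1 else a * (l - shift) powr grig_alpha)"

text \<open>Above the cutoff \<open>(1 - grig_eta) * l\<close> exceeds 6, which outweighs the
  additive constant. The drop by one makes the recursion in \<open>tree_code\<close>
  terminate.\<close>

lemma section_length_bound:
  assumes "cutoff < l" "0 \<le> l0" "0 \<le> l1" "l0 + l1 \<le> grig_eta * (l + cweight A)"
  shows "l0 \<le> l - 1" "l1 \<le> l - 1"
proof -
  have "6 < (1 - grig_eta) * l" using assms(1) grig_eta_bounds by (simp add: cutoff_def field_simps)
  moreover have "grig_eta * cweight A \<le> 1 * 1"
    using grig_eta_bounds cweight_A_less cweight_pos[of A]
    by (intro mult_mono) (auto simp del: cweight.simps)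
  ultimately have "grig_eta * (l + cweight A) \<le> l - 1"
    by (simp add: algebra_simps del: cweight.simps)
  then show "l0 \<le> l - 1" "l1 \<le> l - 1" using assms by linarith+
qed

text \<open>If both children are leaves, a large \<open>a\<close> suffices. If one is, the other has
  shrunk by a factor below 1, and the saving pays for the leaf. If neither is, concavity, the
  contraction by \<open>\<eta>\<close> and \<open>grig_alpha_eq\<close> give the claim without
  loss.\<close>

lemma leaf_bound_exists:
  obtains a where "0 < a" "\<And>l. 1 \<le> leaf_bound a l"
    "\<And>l l0 l1. cutoff < l \<Longrightarrow> 0 \<le> l0 \<Longrightarrow> 0 \<le> l1 \<Longrightarrow> l0 + l1 \<le> grig_eta * (l + cweight A)
       \<Longrightarrow> leaf_bound a l0 + leaf_bound a l1 \<le> leaf_bound a l"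
proof -
  define M where "M = cutoff - shift"
  \<comment> \<open>\<open>\<theta>\<close> lies between \<open>\<eta>\<close> and 1, and the gap
    absorbs the additive constant above the cutoff. \<open>\<kappa>\<close> is a fraction that is
    then saved, and \<open>a\<close> makes this fraction worth 2 already at the cutoff.\<close>
  define \<theta> where "\<theta> = (1 + grig_eta) / 2"
  define \<kappa> where "\<kappa> = min 1 (1 - \<theta> powr grig_alpha)"
  define a where "a = 2 / (\<kappa> * M powr grig_alpha)"
  have \<theta>: "0 < \<theta>" "\<theta> < 1" using grig_eta_bounds by (auto simp: \<theta>_def)
  have "\<theta> powr grig_alpha < 1 powr grig_alpha"
    using \<theta> grig_alpha_bounds by (intro powr_less_mono2) auto
  then have \<kappa>: "0 < \<kappa>" "\<kappa> \<le> 1" "\<kappa> \<le> 1 - \<theta> powr grig_alpha" by (auto simp: \<kappa>_def)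
  have M: "0 < M" using cutoff_ge shift_bounds by (simp add: M_def)
  have a: "0 < a" using \<kappa> M by (simp add: a_def)
  have a_eq: "a * \<kappa> * M powr grig_alpha = 2" using \<kappa> M by (simp add: a_def)
  have big: "2 \<le> a * \<kappa> * (l - shift) powr grig_alpha" if "cutoff < l" for l
  proof -
    have "M powr grig_alpha \<le> (l - shift) powr grig_alpha"
      using M that grig_alpha_bounds by (intro powr_mono2) (auto simp: M_def)
    then have "a * \<kappa> * M powr grig_alpha \<le> a * \<kappa> * (l - shift) powr grig_alpha"
      using a \<kappa> by (intro mult_left_mono) auto
    then show ?thesis using a_eq by simp
  qed
  have big': "2 \<le> a * (l - shift) powr grig_alpha" if "cutoff < l" for l
  proof -
    have "\<kappa> * (a * (l - shift) powr grig_alpha) \<le> 1 * (a * (l - shift) powr grig_alpha)"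
      using a \<kappa> by (intro mult_right_mono) auto
    then show ?thesis using big[OF that] by (simp add: mult_ac)
  qed
  have one_leaf: "1 + a * (l1 - shift) powr grig_alpha \<le> a * (l - shift) powr grig_alpha"
    if l: "cutoff < l" "cutoff < l1" "l1 \<le> grig_eta * (l + cweight A)" for l l1
  proof -
    have "6 < (1 - grig_eta) * l" using l(1) grig_eta_bounds by (simp add: cutoff_def field_simps)
    moreover have "grig_eta * cweight A \<le> 1 * 1"
      using grig_eta_bounds cweight_A_less cweight_pos[of A]
    by (intro mult_mono) (auto simp del: cweight.simps)
    moreover have "\<theta> * shift \<le> 1 * 1" using \<theta> shift_bounds by (intro mult_mono) auto
    ultimately have "l1 - shift \<le> \<theta> * (l - shift)"
      using l(3) shift_bounds by (simp add: \<theta>_def algebra_simps del: cweight.simps)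
    then have "(l1 - shift) powr grig_alpha \<le> (\<theta> * (l - shift)) powr grig_alpha"
      using l cutoff_ge shift_bounds grig_alpha_bounds by (intro powr_mono2) auto
    also have "\<dots> = \<theta> powr grig_alpha * (l - shift) powr grig_alpha"
      using \<theta> l cutoff_ge shift_bounds by (simp add: powr_mult)
    also have "\<dots> \<le> (1 - \<kappa>) * (l - shift) powr grig_alpha"
      using \<kappa> by (intro mult_right_mono) auto
    finally have "a * (l1 - shift) powr grig_alpha \<le> a * ((1 - \<kappa>) * (l - shift) powr grig_alpha)"
      using a by (intro mult_left_mono) auto
    then show ?thesis using big[OF l(1)] by (simp add: algebra_simps)
  qed
  show thesis
  proof
    show "0 < a" by fact
    show "1 \<le> leaf_bound a l" for l
      using big'[of l] by (cases "l \<le> cutoff") (simp_all add: leaf_bound_def)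
    fix l l0 l1 :: real
    assume l: "cutoff < l" "0 \<le> l0" "0 \<le> l1" "l0 + l1 \<le> grig_eta * (l + cweight A)"
    consider "l0 \<le> cutoff" "l1 \<le> cutoff" | "l0 \<le> cutoff" "cutoff < l1"
      | "cutoff < l0" "l1 \<le> cutoff" | "cutoff < l0" "cutoff < l1" by linarith
    then show "leaf_bound a l0 + leaf_bound a l1 \<le> leaf_bound a l"
    proof cases
      case 1
      then show ?thesis using big'[OF l(1)] l(1) by (simp add: leaf_bound_def)
    next
      case 2
      then show ?thesis using one_leaf[of l l1] l by (simp add: leaf_bound_def del: cweight.simps)
    next
      case 3
      then show ?thesis using one_leaf[of l l0] l by (simp add: leaf_bound_def del: cweight.simps)
    next
      case 4
      have "(l0 - shift) powr grig_alpha + (l1 - shift) powr grig_alpha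
          \<le> 2 * ((l0 - shift + (l1 - shift)) / 2) powr grig_alpha"
        using 4 cutoff_ge shift_bounds grig_alpha_bounds by (intro powr_add_le) auto
      also have "\<dots> \<le> 2 * (grig_eta / 2 * (l - shift)) powr grig_alpha"
      proof (intro mult_left_mono powr_mono2)
        show "(l0 - shift + (l1 - shift)) / 2 \<le> grig_eta / 2 * (l - shift)"
          using l(4) shift_eq by (simp add: field_simps del: cweight.simps)
      qed (use 4 cutoff_ge shift_bounds grig_alpha_bounds in auto)
      also have "\<dots> = 2 * (grig_eta / 2) powr grig_alpha * (l - shift) powr grig_alpha"
        using grig_eta_bounds l(1) cutoff_ge shift_bounds by (subst powr_mult) auto
      also have "\<dots> = (l - shift) powr grig_alpha"
        unfolding grig_alpha_eq by simp
      finally have "a * ((l0 - shift) powr grig_alpha + (l1 - shift) powr grig_alpha)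
          \<le> a * (l - shift) powr grig_alpha"
        using a by (intro mult_left_mono) auto
      then show ?thesis using 4 l(1) by (simp add: leaf_bound_def distrib_left)
    qed
  qed
qed


section \<open>Coding elements by their trees of sections\<close>

fun node :: "bool \<Rightarrow> (bool list \<Rightarrow> bool list) \<Rightarrow> (bool list \<Rightarrow> bool list) \<Rightarrow> bool list \<Rightarrow> bool list" where
  "node e g0 g1 [] = []"
| "node e g0 g1 (x # s) = (x \<noteq> e) # (if x then g1 s else g0 s)"

lemma eval_node: "eval ws = node (parity ws) (eval (word_section False ws)) (eval (word_section True ws))"
proof
  show "eval ws s = node (parity ws) (eval (word_section False ws)) (eval (word_section True ws)) s" for s
    by (cases s) (auto simp: eval_Cons)
qed

text \<open>Group elements are encoded by the preorder listing of their tree of iterated sections, with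
  elements of bounded weight at the leaves. The listing is decoded by a stack machine reading it
  from the right.\<close>

fun push :: "(bool list \<Rightarrow> bool list) + bool \<Rightarrow> (bool list \<Rightarrow> bool list) list \<Rightarrow>
    (bool list \<Rightarrow> bool list) list" where
  "push (Inl g) st = g # st"
| "push (Inr e) (g0 # g1 # st) = node e g0 g1 # st"
| "push (Inr e) st = st"

definition ball :: "real \<Rightarrow> (bool list \<Rightarrow> bool list) set" where
  "ball r = eval ` {ws. cw ws \<le> r}"

lemma finite_letters: "finite (UNIV :: letter set)"
proof -
  have "l \<in> {A, B, C, D}" for l by (cases l) auto
  then have "(UNIV :: letter set) = {A, B, C, D}" by blast
  then show ?thesis by (metis finite.emptyI finite_insert)
qed

lemma finite_ball: "finite (ball r)"
proof -
  obtain w where w: "w > 0" "\<And>l. l \<in> UNIV \<Longrightarrow> w \<le> cweight l"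
    using weights_bounded_below[OF finite_letters, of cweight] cweight_pos by metis
  have "{ws. cw ws \<le> r} \<subseteq> {ws. set ws \<subseteq> UNIV \<and> length ws \<le> nat \<lceil>r / w\<rceil>}"
  proof safe
    fix ws assume "cw ws \<le> r"
    then have "real (length ws) * w \<le> r"
      using length_le_weight[of UNIV w cweight ws] w by force
    then have "real (length ws) \<le> r / w" using w by (simp add: field_simps)
    then show "length ws \<le> nat \<lceil>r / w\<rceil>" by linarith
  qed simp
  then show ?thesis unfolding ball_def
    using finite_lists_length_le[OF finite_letters] finite_subset by blast
qed

text \<open>A full binary tree with \<open>L\<close> leaves has \<open>2 * L - 1\<close> nodes,
  which explains the length bound. Quantifying over the stack \<open>st\<close> lets the codes of
  the two subtrees be concatenated.\<close>

lemma tree_code: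
  assumes a: "\<And>l. 1 \<le> leaf_bound a l"
    "\<And>l l0 l1. cutoff < l \<Longrightarrow> 0 \<le> l0 \<Longrightarrow> 0 \<le> l1 \<Longrightarrow> l0 + l1 \<le> grig_eta * (l + cweight A)
       \<Longrightarrow> leaf_bound a l0 + leaf_bound a l1 \<le> leaf_bound a l"
    and "g \<in> ball r"
  shows "\<exists>w. set w \<subseteq> Inl ` ball cutoff \<union> range Inr \<and> real (length w) \<le> 2 * leaf_bound a r - 1
    \<and> (\<forall>st. foldr push w st = g # st)"
  using assms(3)
proof (induction "nat \<lceil>r\<rceil>" arbitrary: g r rule: less_induct)
  case less
  show ?case
  proof (cases "r \<le> cutoff")
    case True
    then have "g \<in> ball cutoff" using less.prems by (auto simp: ball_def)
    moreover have "leaf_bound a r = 1" using True by (simp add: leaf_bound_def)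
    ultimately show ?thesis by (intro exI[of _ "[Inl g]"]) auto
  next
    case False
    then have r: "cutoff < r" by simp
    obtain ws' where "g = eval ws'" "cw ws' \<le> r" using less.prems by (auto simp: ball_def)
    then obtain ws where ws: "alternating ws" "eval ws = g" "cw ws \<le> r"
      by (metis alternating_reduction[OF triangular_cweight, of ws'] order_trans)
    define u0 where "u0 = word_section False ws"
    define u1 where "u1 = word_section True ws"
    have "cw u0 + cw u1 \<le> grig_eta * (cw ws + cweight A)"
      using cw_sections[OF ws(1)] by (simp only: u0_def u1_def)
    also have "\<dots> \<le> grig_eta * (r + cweight A)"
      using grig_eta_bounds ws(3) by (intro mult_left_mono add_mono) auto
    finally have sum: "cw u0 + cw u1 \<le> grig_eta * (r + cweight A)" .
    have small: "cw u0 \<le> r - 1" "cw u1 \<le> r - 1"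
      using section_length_bound[OF r cw_nonneg cw_nonneg sum] by auto
    have IH: "\<exists>w. set w \<subseteq> Inl ` ball cutoff \<union> range Inr \<and>
        real (length w) \<le> 2 * leaf_bound a (cw u) - 1 \<and> (\<forall>st. foldr push w st = eval u # st)"
      if "cw u \<le> r - 1" for u
    proof (rule less.hyps)
      show "nat \<lceil>cw u\<rceil> < nat \<lceil>r\<rceil>" using that r cutoff_ge by linarith
      show "eval u \<in> ball (cw u)" by (auto simp: ball_def)
    qed
    obtain w0 w1 where w:
      "set w0 \<subseteq> Inl ` ball cutoff \<union> range Inr" "real (length w0) \<le> 2 * leaf_bound a (cw u0) - 1"
      "\<And>st. foldr push w0 st = eval u0 # st"
      "set w1 \<subseteq> Inl ` ball cutoff \<union> range Inr" "real (length w1) \<le> 2 * leaf_bound a (cw u1) - 1"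
      "\<And>st. foldr push w1 st = eval u1 # st"
      using IH[OF small(1)] IH[OF small(2)] by blast
    have "g = node (parity ws) (eval u0) (eval u1)"
      using eval_node[of ws] ws(2) by (simp add: u0_def u1_def)
    then have "foldr push (Inr (parity ws) # w0 @ w1) st = g # st" for st
      by (simp add: w(3,6))
    moreover have "real (length (Inr (parity ws) # w0 @ w1)) \<le> 2 * leaf_bound a r - 1"
      using w(2,5) a(2)[OF r cw_nonneg cw_nonneg sum] by simp
    ultimately show ?thesis using w(1,4)
      by (intro exI[of _ "Inr (parity ws) # w0 @ w1"]) auto
  qed
qed

lemma geometric_sum_le:
  fixes q :: nat
  assumes "2 \<le> q"
  shows "(\<Sum>i\<le>n. q ^ i) \<le> q ^ Suc n"
proof (induction n)
  case (Suc n)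
  have "(\<Sum>i\<le>Suc n. q ^ i) \<le> 2 * q ^ Suc n" using Suc by simp
  also have "\<dots> \<le> q * q ^ Suc n" using assms by (intro mult_right_mono) auto
  finally show ?case by simp
qed (use assms in simp)

text \<open>Decoding maps the words over a fixed finite alphabet, of length linear in
  \<open>leaf_bound a r\<close>, onto a set containing the ball. The summand 1 in the exponent
  covers radii below the cutoff.\<close>

lemma card_ball_le:
  obtains c where "0 < c" "\<And>r. 0 \<le> r \<Longrightarrow> real (card (ball r)) \<le> exp (c * (1 + r powr grig_alpha))"
proof -
  obtain a where a: "0 < a" "\<And>l. 1 \<le> leaf_bound a l"
    "\<And>l l0 l1. cutoff < l \<Longrightarrow> 0 \<le> l0 \<Longrightarrow> 0 \<le> l1 \<Longrightarrow> l0 + l1 \<le> grig_eta * (l + cweight A)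
       \<Longrightarrow> leaf_bound a l0 + leaf_bound a l1 \<le> leaf_bound a l"
    using leaf_bound_exists by blast
  define Q :: "((bool list \<Rightarrow> bool list) + bool) set" where "Q = Inl ` ball cutoff \<union> range Inr"
  define q where "q = card Q"
  have fQ: "finite Q" using finite_ball by (simp add: Q_def)
  have "card (range (Inr :: bool \<Rightarrow> (bool list \<Rightarrow> bool list) + bool)) = 2"
    by (subst card_image) auto
  moreover have "card (range (Inr :: bool \<Rightarrow> (bool list \<Rightarrow> bool list) + bool)) \<le> card Q"
    using fQ by (intro card_mono) (auto simp: Q_def)
  ultimately have q: "2 \<le> q" by (simp add: q_def)
  have lnq: "0 < ln (real q)" using q by simp
  show thesis
  proof
    show "0 < (3 + 2 * a) * ln (real q)" using a lnq by simp
    fix r :: real assume r: "0 \<le> r"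
    define N where "N = nat \<lfloor>2 * leaf_bound a r\<rfloor>"
    have "ball r \<subseteq> (\<lambda>w. hd (foldr push w [])) ` {w. set w \<subseteq> Q \<and> length w \<le> N}"
    proof
      fix g assume "g \<in> ball r"
      from tree_code[OF a(2,3) this] obtain w where w: "set w \<subseteq> Q"
        "real (length w) \<le> 2 * leaf_bound a r - 1" "foldr push w [] = [g]"
        unfolding Q_def by blast
      then have "length w \<le> N" unfolding N_def by linarith
      then show "g \<in> (\<lambda>w. hd (foldr push w [])) ` {w. set w \<subseteq> Q \<and> length w \<le> N}"
        using w by (intro image_eqI[of _ _ w]) auto
    qed
    then have "card (ball r) \<le> card {w. set w \<subseteq> Q \<and> length w \<le> N}"
      by (rule surj_card_le[OF finite_lists_length_le[OF fQ]])
    also have "\<dots> = (\<Sum>i\<le>N. q ^ i)" using card_lists_length_le[OF fQ] by (simp add: q_def)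
    also have "\<dots> \<le> q ^ Suc N" by (rule geometric_sum_le[OF q])
    finally have "real (card (ball r)) \<le> real q ^ Suc N" by (metis of_nat_le_iff of_nat_power)
    also have "\<dots> = exp (real (Suc N) * ln (real q))"
      by (subst exp_of_nat_mult) (use q in simp)
    also have "\<dots> \<le> exp ((3 + 2 * a * r powr grig_alpha) * ln (real q))"
    proof -
      have "leaf_bound a r \<le> 1 + a * r powr grig_alpha"
      proof (cases "r \<le> cutoff")
        case False
        then have "(r - shift) powr grig_alpha \<le> r powr grig_alpha"
          using shift_bounds cutoff_ge grig_alpha_bounds by (intro powr_mono2) auto
        then have "a * (r - shift) powr grig_alpha \<le> a * r powr grig_alpha"
          using a(1) by (intro mult_left_mono) auto
        then show ?thesis using False by (simp add: leaf_bound_def)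
      qed (use a(1) in \<open>simp add: leaf_bound_def\<close>)
      moreover have "real N \<le> 2 * leaf_bound a r" using a(2)[of r] unfolding N_def by linarith
      ultimately have "real (Suc N) \<le> 3 + 2 * a * r powr grig_alpha" by simp
      then show ?thesis using lnq by (intro exp_le_cancel_iff[THEN iffD2] mult_right_mono) auto
    qed
    also have "\<dots> \<le> exp ((3 + 2 * a) * ln (real q) * (1 + r powr grig_alpha))"
    proof -
      have "3 + 2 * a * r powr grig_alpha \<le> (3 + 2 * a) * (1 + r powr grig_alpha)"
        using a(1) by (simp add: algebra_simps)
      then have "(3 + 2 * a * r powr grig_alpha) * ln (real q)
          \<le> ((3 + 2 * a) * (1 + r powr grig_alpha)) * ln (real q)"
        using lnq by (intro mult_right_mono) auto
      then show ?thesis by (simp add: mult_ac)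
    qed
    finally show "real (card (ball r)) \<le> exp ((3 + 2 * a) * ln (real q) * (1 + r powr grig_alpha))" .
  qed
qed



section \<open>The lower bound\<close>

text \<open>A substitution whose section at the letter 1 is the original word, while its section at
  the letter 0 lies in the dihedral group of order 8 generated by \<open>a\<close> and \<open>d\<close>.\<close>

fun subst_letter :: "letter \<Rightarrow> letter list" where
  "subst_letter A = [A, C, A]"
| "subst_letter B = [D]"
| "subst_letter C = [B]"
| "subst_letter D = [C]"

fun dihedral_letter :: "letter \<Rightarrow> letter list" where
  "dihedral_letter A = [D]"
| "dihedral_letter B = []"
| "dihedral_letter C = [A]"
| "dihedral_letter D = [A]"

abbreviation lift :: "letter list \<Rightarrow> letter list" where
  "lift ws \<equiv> concat (map subst_letter ws)"

abbreviation shadow :: "letter list \<Rightarrow> letter list" where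
  "shadow ws \<equiv> concat (map dihedral_letter ws)"

lemma eval_lift:
  "eval (lift ws) (True # s) = True # eval ws s"
  "eval (lift ws) (False # s) = False # eval (shadow ws) s"
proof (induction ws)
  case (Cons l ws)
  { case 1 show ?case using Cons by (cases l) (simp_all add: eval_append)
  next case 2 show ?case using Cons by (cases l) (simp_all add: eval_append) }
qed simp_all

section \<open>The dihedral group generated by \<open>a\<close> and \<open>d\<close>\<close>

definition dihedral :: "(bool list \<Rightarrow> bool list) set" where
  "dihedral = eval ` {[], [A], [D], [A, D], [D, A], [A, D, A], [D, A, D], [A, D, A, D]}"

text \<open>\<open>d\<close> acts only below the letter 1 and its conjugate \<open>ada\<close> only
  below 0, so the two commute.\<close>

lemma dihedral_relation:
  "grig_d (grig_a (grig_d (grig_a s))) = grig_a (grig_d (grig_a (grig_d s)))"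
proof (cases s)
  case (Cons x t)
  then show ?thesis by (cases x) simp_all
qed simp

text \<open>Shadows are words in \<open>A\<close> and \<open>D\<close>, and the eight listed
  elements are closed under left multiplication by \<open>a\<close> and \<open>d\<close>.\<close>

lemma eval_shadow_dihedral: "eval (shadow ws) \<in> dihedral"
proof (induction ws)
  case (Cons l ws)
  have step: "eval (k # v) \<in> dihedral" if k: "k = A \<or> k = D" and v: "eval v \<in> dihedral" for k v
  proof -
    obtain u where u: "u \<in> {[], [A], [D], [A, D], [D, A], [A, D, A], [D, A, D], [A, D, A, D]}"
      "eval v = eval u" using v by (auto simp: dihedral_def)
    have "eval (k # v) = eval (k # u)" using u(2) by auto
    moreover have "\<exists>u' \<in> {[], [A], [D], [A, D], [D, A], [A, D, A], [D, A, D], [A, D, A, D]}.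
       \<forall>s. eval (k # u) s = eval u' s"
      using k u(1)
      by (elim disjE insertE)
         (simp_all add: grig_a_involution grig_bcd_involution dihedral_relation)
    ultimately show ?thesis by (auto simp: dihedral_def)
  qed
  show ?case using Cons step by (cases l) (simp_all del: eval.simps)
qed (auto simp: dihedral_def)

lemma finite_dihedral: "finite dihedral" and card_dihedral: "card dihedral \<le> 8"
proof -
  let ?W = "{[], [A], [D], [A, D], [D, A], [A, D, A], [D, A, D], [A, D, A, D]}"
  show "finite dihedral" by (simp add: dihedral_def)
  have "card dihedral \<le> card ?W" unfolding dihedral_def by (rule card_image_le) simp
  also have "\<dots> \<le> 8" by simp
  finally show "card dihedral \<le> 8" .
qed

section \<open>The squaring inequality for the growth\<close>

abbreviation bcd_count :: "letter list \<Rightarrow> nat" where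
  "bcd_count ws \<equiv> length (filter (\<lambda>l. l \<noteq> A) ws)"

text \<open>Letters \<open>A\<close> are free because \<open>lift\<close> turns length into this
  count exactly (\<open>bcd_count_lift\<close>), and an alternating word of count \<open>n\<close>
  has length at most \<open>2 * n + 1\<close>.\<close>

definition bcd_ball :: "nat \<Rightarrow> (bool list \<Rightarrow> bool list) set" where
  "bcd_ball n = eval ` {ws. bcd_count ws \<le> n}"

text \<open>Weight 0 for \<open>A\<close> and 1 for the other letters is triangular, so
  \<open>alternating_reduction\<close> applies.\<close>

lemma bcd_alternating:
  assumes "g \<in> bcd_ball n"
  obtains ws where "alternating ws" "eval ws = g" "bcd_count ws \<le> n"
proof -
  obtain us where us: "eval us = g" "bcd_count us \<le> n" using assms by (auto simp: bcd_ball_def)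
  let ?f = "\<lambda>l. if l = A then 0 else (1::real)"
  have "triangular ?f" by (rule triangularI) auto
  then obtain vs where vs: "alternating vs" "eval vs = eval us" "(\<Sum>l\<leftarrow>vs. ?f l) \<le> (\<Sum>l\<leftarrow>us. ?f l)"
    using alternating_reduction by metis
  have "(\<Sum>l\<leftarrow>ws. ?f l) = real (bcd_count ws)" for ws by (induction ws) auto
  with vs us show thesis by (intro that[of vs]) auto
qed

lemma length_eq_count: "length ws = length (filter (\<lambda>l. l = A) ws) + bcd_count ws"
  by (induction ws) auto

lemma finite_bcd_ball: "finite (bcd_ball n)"
proof -
  have "bcd_ball n \<subseteq> eval ` {ws. set ws \<subseteq> UNIV \<and> length ws \<le> 2 * n + 1}"
  proof
    fix g assume "g \<in> bcd_ball n"
    then obtain ws where ws: "alternating ws" "eval ws = g" "bcd_count ws \<le> n"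
      by (rule bcd_alternating)
    then have "length ws \<le> 2 * n + 1"
      using count_alternating(1)[OF ws(1)] length_eq_count[of ws] by linarith
    then show "g \<in> eval ` {ws. set ws \<subseteq> UNIV \<and> length ws \<le> 2 * n + 1}" using ws by auto
  qed
  then show ?thesis using finite_lists_length_le[OF finite_letters] finite_surj by blast
qed

lemma bcd_ball_mono: "m \<le> n \<Longrightarrow> bcd_ball m \<subseteq> bcd_ball n"
  by (auto simp: bcd_ball_def)

lemma bcd_count_lift: "bcd_count (lift ws) = length ws"
proof (induction ws)
  case (Cons l ws)
  then show ?case by (cases l) auto
qed simp

text \<open>The elements \<open>a (lift u) a (lift v)\<close> have sections \<open>u\<close> and \<open>v\<close> up to dihedral factors,
  so a pair of elements is recovered from its image with an ambiguity of at most \<open>8 * 8\<close>.\<close>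

lemma card_bcd_ball_square: "card (bcd_ball n) ^ 2 \<le> 64 * card (bcd_ball (4 * n + 2))"
proof -
  define W where "W = (\<lambda>g. SOME ws. alternating ws \<and> eval ws = g \<and> bcd_count ws \<le> n)"
  have W: "alternating (W g)" "eval (W g) = g" "bcd_count (W g) \<le> n" if "g \<in> bcd_ball n" for g
  proof -
    have "\<exists>ws. alternating ws \<and> eval ws = g \<and> bcd_count ws \<le> n"
      using that by (rule bcd_alternating) blast
    from someI_ex[OF this] show "alternating (W g)" "eval (W g) = g" "bcd_count (W g) \<le> n"
      by (simp_all add: W_def)
  qed
  define X where "X = (\<lambda>g h. A # lift (W g) @ A # lift (W h))"
  \<comment> \<open>The sections of \<open>X g h\<close> at 0 and 1 are \<open>g\<close> after the
    shadow of \<open>W h\<close>, and the shadow of \<open>W g\<close> after \<open>h\<close>.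
    Recording both shadows makes the map injective: the first is undone by surjectivity, the second
    by injectivity.\<close>
  define \<Phi> where "\<Phi> = (\<lambda>(g, h). (eval (X g h), eval (shadow (W g)), eval (shadow (W h))))"
  have X0: "eval (X g h) (False # s) = False # g (eval (shadow (W h)) s)"
    and X1: "eval (X g h) (True # s) = True # eval (shadow (W g)) (h s)"
    if "g \<in> bcd_ball n" "h \<in> bcd_ball n" for g h s
    using W(2)[OF that(1)] W(2)[OF that(2)] by (simp_all add: X_def eval_append eval_lift)
  have "inj_on \<Phi> (bcd_ball n \<times> bcd_ball n)"
  proof (rule inj_onI, clarify)
    fix g h g' h'
    assume in_ball: "g \<in> bcd_ball n" "h \<in> bcd_ball n" "g' \<in> bcd_ball n" "h' \<in> bcd_ball n"
      and eq: "\<Phi> (g, h) = \<Phi> (g', h')"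
    from eq have e: "eval (X g h) = eval (X g' h')" "eval (shadow (W g)) = eval (shadow (W g'))"
      "eval (shadow (W h)) = eval (shadow (W h'))" by (simp_all add: \<Phi>_def)
    have "g s = g' s" for s
    proof -
      obtain t where t: "s = eval (shadow (W h)) t" using bij_eval by (metis bij_pointE)
      have "False # g (eval (shadow (W h)) t) = False # g' (eval (shadow (W h')) t)"
        using X0[OF in_ball(1,2)] X0[OF in_ball(3,4)] e(1) by metis
      then show ?thesis using t e(3) by simp
    qed
    moreover have "h s = h' s" for s
    proof -
      have "True # eval (shadow (W g)) (h s) = True # eval (shadow (W g')) (h' s)"
        using X1[OF in_ball(1,2)] X1[OF in_ball(3,4)] e(1) by metis
      then have "eval (shadow (W g)) (h s) = eval (shadow (W g)) (h' s)" using e(2) by simp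
      then show ?thesis using bij_eval by (metis bij_pointE)
    qed
    ultimately show "g = g' \<and> h = h'" by blast
  qed
  moreover have "\<Phi> ` (bcd_ball n \<times> bcd_ball n) \<subseteq> bcd_ball (4 * n + 2) \<times> dihedral \<times> dihedral"
  proof (rule image_subsetI)
    fix p assume "p \<in> bcd_ball n \<times> bcd_ball n"
    then obtain g h where p: "p = (g, h)" and gh: "g \<in> bcd_ball n" "h \<in> bcd_ball n" by blast
    \<comment> \<open>Two words of length at most \<open>2 * n + 1\<close> account for
      \<open>4 * n + 2\<close>; the two separating letters \<open>A\<close> are free.\<close>
    have "length (W u) \<le> 2 * n + 1" if "u \<in> bcd_ball n" for u
      using count_alternating(1)[OF W(1)[OF that]] length_eq_count[of "W u"] W(3)[OF that] by linarith
    from this[OF gh(1)] this[OF gh(2)] have "bcd_count (X g h) \<le> 4 * n + 2"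
      by (simp add: X_def bcd_count_lift del: filter_concat)
    then show "\<Phi> p \<in> bcd_ball (4 * n + 2) \<times> dihedral \<times> dihedral"
      by (auto simp: p \<Phi>_def bcd_ball_def eval_shadow_dihedral)
  qed
  ultimately have "card (bcd_ball n \<times> bcd_ball n) \<le> card (bcd_ball (4 * n + 2) \<times> dihedral \<times> dihedral)"
    using finite_bcd_ball finite_dihedral by (intro card_inj_on_le[of \<Phi>]) auto
  also have "\<dots> = card (bcd_ball (4 * n + 2)) * (card dihedral * card dihedral)"
    by (simp add: card_cartesian_product)
  also have "\<dots> \<le> card (bcd_ball (4 * n + 2)) * (8 * 8)"
    using card_dihedral by (intro mult_le_mono) auto
  finally show ?thesis by (simp add: card_cartesian_product power2_eq_square)
qed

section \<open>Starting and iterating the squaring inequality\<close>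

lemma level_transitive:
  assumes "length v = n"
  shows "\<exists>ws. eval ws (replicate n False) = v"
  using assms
proof (induction n arbitrary: v)
  case 0
  then show ?case by auto
next
  case (Suc n)
  then obtain x s where v: "v = x # s" "length s = n" by (cases v) auto
  then obtain u where u: "eval u (replicate n False) = s" using Suc.IH by blast
  \<comment> \<open>\<open>A\<close> moves the first letter 0 to 1, below which
    \<open>lift u\<close> acts as \<open>u\<close>; another \<open>A\<close> leads back to 0 when
    \<open>x\<close> is 0.\<close>
  show ?case
  proof (cases x)
    case True
    then show ?thesis using u v
      by (intro exI[of _ "lift u @ [A]"]) (simp add: eval_append eval_lift)
  next
    case False
    then show ?thesis using u v
      by (intro exI[of _ "A # lift u @ [A]"]) (simp add: eval_append eval_lift)
  qed
qed

text \<open>Transitivity on the \<open>2 ^ 7\<close> vertices of level 7 yields 128 elements, twice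
  the ambiguity 64, so that squaring starts from a ratio of at least 2.\<close>

lemma bcd_ball_large: "\<exists>n. 128 \<le> card (bcd_ball n)"
proof -
  let ?z = "replicate 7 False"
  define V where "V = {v :: bool list. set v \<subseteq> UNIV \<and> length v = 7}"
  have "card V = card (UNIV :: bool set) ^ 7"
    unfolding V_def by (rule card_lists_length_eq) simp
  then have cV: "card V = 128" by simp
  then have fV: "finite V" by (metis card.infinite zero_neq_numeral)
  have "\<exists>W. \<forall>v. v \<in> V \<longrightarrow> eval (W v) ?z = v"
    using level_transitive[of _ 7] by (intro choice) (simp add: V_def)
  then obtain W where W: "\<And>v. v \<in> V \<Longrightarrow> eval (W v) ?z = v" by blast
  define n where "n = Max ((\<lambda>v. bcd_count (W v)) ` V)"
  have "V \<subseteq> (\<lambda>g. g ?z) ` bcd_ball n"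
  proof
    fix v assume v: "v \<in> V"
    then have "bcd_count (W v) \<le> n" unfolding n_def using fV by (intro Max_ge) auto
    then have "eval (W v) \<in> bcd_ball n" by (auto simp: bcd_ball_def)
    then show "v \<in> (\<lambda>g. g ?z) ` bcd_ball n" using W[OF v] by (metis image_eqI)
  qed
  then have "card V \<le> card (bcd_ball n)" by (rule surj_card_le[OF finite_bcd_ball])
  then show ?thesis using cV by auto
qed

text \<open>The ratio of the cardinality to 64 is at least squared when the radius goes from
  \<open>n\<close> to \<open>4 * n + 2\<close>. Since
  \<open>4 * n + 2 \<le> 4 * (n + 1) - 1\<close>, counting from \<open>n + 1\<close> turns this into
  multiplication by 4.\<close>

lemma card_bcd_ball_ge:
  obtains N where "\<And>k. 64 * 2 ^ 2 ^ k \<le> card (bcd_ball (4 ^ k * N - 1))"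
proof -
  obtain n0 where n0: "128 \<le> card (bcd_ball n0)" using bcd_ball_large by blast
  have "64 * 2 ^ 2 ^ k \<le> card (bcd_ball (4 ^ k * (n0 + 1) - 1))" for k
  proof (induction k)
    case (Suc k)
    let ?b = "card (bcd_ball (4 ^ k * (n0 + 1) - 1))"
    have "(64 * 2 ^ 2 ^ k) ^ 2 \<le> ?b ^ 2" by (rule power_mono[OF Suc]) simp
    also have "\<dots> \<le> 64 * card (bcd_ball (4 * (4 ^ k * (n0 + 1) - 1) + 2))"
      by (rule card_bcd_ball_square)
    also have "\<dots> \<le> 64 * card (bcd_ball (4 ^ Suc k * (n0 + 1) - 1))"
    proof (intro mult_le_mono2 card_mono finite_bcd_ball bcd_ball_mono)
      have "0 < (4::nat) ^ k * (n0 + 1)" by simp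
      then show "4 * (4 ^ k * (n0 + 1) - 1) + 2 \<le> 4 ^ Suc k * (n0 + 1) - 1"
        unfolding power_Suc mult.assoc by linarith
    qed
    finally have "64 * (64 * (2 ^ 2 ^ k) ^ 2) \<le> 64 * card (bcd_ball (4 ^ Suc k * (n0 + 1) - 1))"
      by (simp add: power_mult_distrib)
    moreover have "(2::nat) ^ 2 ^ Suc k = (2 ^ 2 ^ k) ^ 2" by (simp add: power_mult mult.commute flip: power_mult)
    ultimately show ?case by simp
  qed (use n0 in simp)
  then show thesis by (rule that)
qed

text \<open>For the least \<open>k\<close> with \<open>x \<le> 4 ^ k\<close>, both
  \<open>sqrt x \<le> 2 ^ k\<close> and \<open>4 ^ k \<le> 4 * (1 + x)\<close> hold.\<close>

lemma bcd_ball_exp_sqrt: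
  obtains N where
    "\<And>x. 0 \<le> x \<Longrightarrow> \<exists>n. real n \<le> real N * (1 + x) \<and> exp (sqrt x) \<le> card (bcd_ball n)"
proof -
  obtain N where N: "\<And>k. 64 * 2 ^ 2 ^ k \<le> card (bcd_ball (4 ^ k * N - 1))"
    using card_bcd_ball_ge by blast
  have "\<exists>n. real n \<le> real (16 * N) * (1 + x) \<and> exp (sqrt x) \<le> card (bcd_ball n)" if x: "0 \<le> x" for x
  proof -
    define k where "k = (LEAST k. x \<le> 4 ^ k)"
    obtain j where "x < 4 ^ j" using real_arch_pow[of 4 x] by auto
    then have xk: "x \<le> 4 ^ k" unfolding k_def by (intro LeastI[of "\<lambda>k. x \<le> 4 ^ k" j]) simp
    have k4: "4 ^ k \<le> 4 * (1 + x)"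
    proof (cases k)
      case (Suc i)
      then have "\<not> x \<le> 4 ^ i" using not_less_Least[of i "\<lambda>k. x \<le> 4 ^ k"] by (simp add: k_def)
      then show ?thesis using Suc by simp
    qed (use x in simp)
    have "sqrt x \<le> sqrt (4 ^ k)" using xk by simp
    also have "sqrt (4 ^ k) = 2 ^ k"
      by (rule real_sqrt_unique) (simp_all add: power2_eq_square flip: power_mult_distrib)
    finally have "exp (sqrt x) \<le> exp (2 ^ k)" by simp
    also have "exp (2 ^ k) = exp (1::real) ^ (2 ^ k)" by (simp flip: exp_of_nat_mult)
    \<comment> \<open>Bounding \<open>e\<close> by 4 rather than 2 costs one more squaring, hence
      \<open>Suc k\<close> and the constant 16.\<close>
    also have "\<dots> \<le> 4 ^ (2 ^ k)" using exp_le by (intro power_mono) auto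
    also have "\<dots> = 2 ^ 2 ^ Suc k" by (simp add: power_mult)
    also have "\<dots> \<le> 64 * 2 ^ 2 ^ Suc k" by simp
    also have "\<dots> \<le> real (card (bcd_ball (4 ^ Suc k * N - 1)))"
      using N[of "Suc k"] by (metis of_nat_le_iff of_nat_mult of_nat_numeral of_nat_power)
    finally have "exp (sqrt x) \<le> real (card (bcd_ball (4 ^ Suc k * N - 1)))" .
    moreover have "real (4 ^ Suc k * N - 1) \<le> real (16 * N) * (1 + x)"
    proof -
      have "real (4 ^ Suc k * N - 1) \<le> real (4 ^ Suc k * N)" by linarith
      also have "\<dots> = 4 * 4 ^ k * real N" by simp
      also have "\<dots> \<le> 4 * (4 * (1 + x)) * real N"
        using k4 x by (intro mult_right_mono mult_left_mono) auto
      finally show ?thesis by (simp add: mult_ac)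
    qed
    ultimately show ?thesis by blast
  qed
  then show thesis by (rule that)
qed



section \<open>The group\<close>

lemma Bij_eval: "eval ws \<in> Bij UNIV"
  using bij_eval by (simp add: Bij_def)

lemma eval_single: "eval [l] = act l"
  by auto

lemma grigorchuk_ops:
  "\<one>\<^bsub>grigorchuk_group\<^esub> = eval []"
  "eval us \<otimes>\<^bsub>grigorchuk_group\<^esub> eval vs = eval (us @ vs)"
proof -
  show "\<one>\<^bsub>grigorchuk_group\<^esub> = eval []"
    by (auto simp: grigorchuk_group_def BijGroup_def)
  show "eval us \<otimes>\<^bsub>grigorchuk_group\<^esub> eval vs = eval (us @ vs)"
    using Bij_eval by (auto simp: grigorchuk_group_def BijGroup_def compose_def eval_append)
qed

text \<open>The generators are involutions, so words without inverses already fill the generated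
  subgroup.\<close>

lemma carrier_grigorchuk: "carrier grigorchuk_group = range eval"
proof -
  let ?X = "{grig_a, grig_b, grig_c, grig_d}"
  interpret group "BijGroup (UNIV :: bool list set)" by (rule group_BijGroup)
  have car: "carrier grigorchuk_group = generate (BijGroup UNIV) ?X"
    using grig_generators_Bij
    by (simp add: grigorchuk_group_def carrier_subgroup_generated Int_absorb1)
  have ops: "\<one>\<^bsub>BijGroup UNIV\<^esub> = eval []" "eval us \<otimes>\<^bsub>BijGroup UNIV\<^esub> eval vs = eval (us @ vs)" for us vs
    using grigorchuk_ops(1) grigorchuk_ops(2)[of us vs] by (simp_all add: grigorchuk_group_def)
  have gen: "\<exists>l. h = eval [l]" if "h \<in> ?X" for h
    using that by (elim insertE) (simp_all add: eval_single, (metis act.simps)+)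
  show ?thesis unfolding car
  proof (intro equalityI subsetI)
    fix g assume "g \<in> generate (BijGroup UNIV) ?X"
    then show "g \<in> range eval"
    proof induction
      case (inv h)
      then obtain l where l: "h = eval [l]" using gen by blast
      have "eval ([l] @ [l]) = eval []" by auto
      then have "inv\<^bsub>BijGroup UNIV\<^esub> h = h"
        using l Bij_eval[of "[l]"] by (intro inv_equality) (simp_all only: ops, simp_all add: BijGroup_def)
      then show ?case using l by (metis rangeI)
    next
      case (eng h1 h2)
      then show ?case using ops(2) by (metis (no_types, lifting) imageE rangeI)
    next
      case one
      then show ?case by (simp only: ops rangeI)
    next
      case (incl h)
      then show ?case using gen by (metis rangeI)
    qed
  next
    fix g assume "g \<in> range eval"
    then obtain ws where "g = eval ws" by blast
    moreover have "eval ws \<in> generate (BijGroup UNIV) ?X"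
    proof (induction ws)
      case Nil
      then show ?case by (metis generate.one ops(1))
    next
      case (Cons l ws)
      have "eval [l] \<in> ?X" unfolding eval_single by (cases l) auto
      then have "eval [l] \<otimes>\<^bsub>BijGroup UNIV\<^esub> eval ws \<in> generate (BijGroup UNIV) ?X"
        using Cons by (metis generate.eng generate.incl)
      then show ?case by (simp only: ops append_Cons append_Nil)
    qed
    ultimately show "g \<in> generate (BijGroup UNIV) ?X" by simp
  qed
qed

lemma word_prod_eval:
  assumes "\<And>s. s \<in> set ss \<Longrightarrow> eval (h s) = s"
  shows "word_prod grigorchuk_group ss = eval (concat (map h ss))"
  using assms
proof (induction ss)
  case Nil
  then show ?case by (simp add: word_prod_def grigorchuk_ops(1))
next
  case (Cons s ss)
  then have "s = eval (h s)" by simp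
  then have "word_prod grigorchuk_group (s # ss) = eval (h s) \<otimes>\<^bsub>grigorchuk_group\<^esub> eval (concat (map h ss))"
    using Cons by (simp add: word_prod_def)
  then show ?case by (simp add: grigorchuk_ops(2))
qed

lemma sum_list_concat_le:
  fixes f :: "'b \<Rightarrow> real" and M :: real
  assumes "\<And>s. s \<in> set ss \<Longrightarrow> (\<Sum>l\<leftarrow>h s. f l) \<le> M * \<omega> s"
  shows "(\<Sum>l\<leftarrow>concat (map h ss). f l) \<le> M * (\<Sum>s\<leftarrow>ss. \<omega> s)"
  using assms by (induction ss) (auto simp: distrib_left intro!: add_mono)

section \<open>Comparison with arbitrary generating sets and weights\<close>

locale weighted_generators =
  fixes S :: "(bool list \<Rightarrow> bool list) set" and \<omega> :: "(bool list \<Rightarrow> bool list) \<Rightarrow> real"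
  assumes finite_S: "finite S" and gen_S: "monoid_generating_set grigorchuk_group S"
    and \<omega>_pos: "\<And>s. s \<in> S \<Longrightarrow> \<omega> s > 0"
begin

abbreviation "wl \<equiv> weighted_length grigorchuk_group S \<omega>"

lemma wl_attained:
  assumes "g \<in> carrier grigorchuk_group"
  obtains ss where "set ss \<subseteq> S" "word_prod grigorchuk_group ss = g" "wl g = (\<Sum>s\<leftarrow>ss. \<omega> s)"
    "\<And>vs. set vs \<subseteq> S \<Longrightarrow> word_prod grigorchuk_group vs = g \<Longrightarrow> (\<Sum>s\<leftarrow>ss. \<omega> s) \<le> (\<Sum>s\<leftarrow>vs. \<omega> s)"
  using weighted_length_attained[of S \<omega> grigorchuk_group g thesis] finite_S \<omega>_pos gen_S assms by blast

lemma generator_words: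
  obtains h where "\<And>s. s \<in> S \<Longrightarrow> eval (h s) = s"
proof -
  have "\<exists>h. \<forall>s. s \<in> S \<longrightarrow> eval (h s) = s"
  proof (intro choice allI)
    fix s show "\<exists>w. s \<in> S \<longrightarrow> eval w = s"
      using gen_S by (auto simp: monoid_generating_set_def carrier_grigorchuk image_iff)
  qed
  then show thesis using that by blast
qed

lemma growth_set_subset_ball:
  obtains M where "0 < M" "\<And>n. {g \<in> carrier grigorchuk_group. wl g \<le> n} \<subseteq> ball (M * n)"
proof -
  obtain h where h: "\<And>s. s \<in> S \<Longrightarrow> eval (h s) = s"
    using generator_words by blast
  \<comment> \<open>The sum dominates each single ratio; adding 1 keeps \<open>M\<close>
    positive.\<close>
  define M where "M = 1 + (\<Sum>s\<in>S. cw (h s) / \<omega> s)"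
  have nonneg: "0 \<le> cw (h s) / \<omega> s" if "s \<in> S" for s
    using \<omega>_pos[OF that] cw_nonneg by simp
  have M: "cw (h s) \<le> M * \<omega> s" if "s \<in> S" for s
  proof -
    have "cw (h s) / \<omega> s \<le> (\<Sum>s\<in>S. cw (h s) / \<omega> s)"
      using that nonneg finite_S by (intro member_le_sum) auto
    then have "cw (h s) / \<omega> s \<le> M" by (simp add: M_def)
    then show ?thesis using \<omega>_pos[OF that] by (simp add: pos_divide_le_eq)
  qed
  show thesis
  proof
    show "0 < M" using sum_nonneg[of S "\<lambda>s. cw (h s) / \<omega> s"] nonneg by (simp add: M_def)
    fix n
    show "{g \<in> carrier grigorchuk_group. wl g \<le> n} \<subseteq> ball (M * n)"
    proof safe
      fix g assume g: "g \<in> carrier grigorchuk_group" "wl g \<le> n"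
      obtain ss where ss: "set ss \<subseteq> S" "word_prod grigorchuk_group ss = g" "wl g = (\<Sum>s\<leftarrow>ss. \<omega> s)"
        using wl_attained[OF g(1)] .
      have "cw (concat (map h ss)) \<le> M * (\<Sum>s\<leftarrow>ss. \<omega> s)"
        using ss(1) M by (intro sum_list_concat_le) auto
      also have "\<dots> \<le> M * n" using ss(3) g(2) \<open>0 < M\<close> by (intro mult_left_mono) auto
      finally have "cw (concat (map h ss)) \<le> M * n" .
      moreover have "g = eval (concat (map h ss))"
        using word_prod_eval[of ss h] h ss by blast
      ultimately show "g \<in> ball (M * n)" by (auto simp: ball_def)
    qed
  qed
qed

lemma finite_growth_set: "finite {g \<in> carrier grigorchuk_group. wl g \<le> n}"
  using growth_set_subset_ball finite_ball finite_subset by metis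

lemma bcd_ball_subset_growth_set:
  obtains M where "0 < M"
    "\<And>n. bcd_ball n \<subseteq> {g \<in> carrier grigorchuk_group. wl g \<le> M * (2 * real n + 1)}"
proof -
  have "\<exists>k. \<forall>l. set (k l) \<subseteq> S \<and> word_prod grigorchuk_group (k l) = eval [l]"
  proof (intro choice allI)
    fix l
    have "eval [l] \<in> carrier grigorchuk_group" by (simp add: carrier_grigorchuk del: eval.simps)
    then show "\<exists>w. set w \<subseteq> S \<and> word_prod grigorchuk_group w = eval [l]"
      using gen_S unfolding monoid_generating_set_def by blast
  qed
  then obtain k where k: "\<And>l. set (k l) \<subseteq> S" "\<And>l. word_prod grigorchuk_group (k l) = eval [l]"
    by blast
  \<comment> \<open>Translating generators back into letters reduces the multiplicativity of
    \<open>word_prod\<close> to \<open>eval_append\<close>.\<close>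
  obtain h where h: "\<And>s. s \<in> S \<Longrightarrow> eval (h s) = s"
    using generator_words by blast
  have wp: "word_prod grigorchuk_group (concat (map k ws)) = eval ws" for ws
  proof (induction ws)
    case Nil
    then show ?case by (simp add: word_prod_def grigorchuk_ops(1))
  next
    case (Cons l ws)
    have hk: "word_prod grigorchuk_group ss = eval (concat (map h ss))" if "set ss \<subseteq> S" for ss
      using word_prod_eval[of ss h] h that by blast
    have sub: "set (concat (map k vs)) \<subseteq> S" for vs using k(1) by auto
    have "word_prod grigorchuk_group (concat (map k (l # ws)))
        = eval (concat (map h (k l)) @ concat (map h (concat (map k ws))))"
      using hk[OF sub[of "l # ws"]] by simp
    also have "\<dots> = eval [l] \<circ> eval ws"
      using hk[OF k(1)[of l]] hk[OF sub[of ws]] k(2)[of l] Cons by (auto simp: eval_append)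
    also have "\<dots> = eval (l # ws)" by auto
    finally show ?case .
  qed
  define M where "M = 1 + (\<Sum>l\<in>UNIV. \<Sum>s\<leftarrow>k l. \<omega> s)"
  have nonneg: "0 \<le> (\<Sum>s\<leftarrow>k l. \<omega> s)" for l
    using k(1)[of l] \<omega>_pos by (intro sum_list_nonneg) (auto intro: less_imp_le)
  have M: "(\<Sum>s\<leftarrow>k l. \<omega> s) \<le> M * 1" for l
    using member_le_sum[of l UNIV "\<lambda>l. \<Sum>s\<leftarrow>k l. \<omega> s"] nonneg finite_letters by (simp add: M_def)
  show thesis
  proof
    show M0: "0 < M" using sum_nonneg[of UNIV "\<lambda>l. \<Sum>s\<leftarrow>k l. \<omega> s"] nonneg by (simp add: M_def)
    fix n
    show "bcd_ball n \<subseteq> {g \<in> carrier grigorchuk_group. wl g \<le> M * (2 * real n + 1)}"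
    proof
      fix g assume "g \<in> bcd_ball n"
      then obtain ws where ws: "alternating ws" "eval ws = g" "bcd_count ws \<le> n"
        by (rule bcd_alternating)
      have g: "g \<in> carrier grigorchuk_group" using ws(2) by (auto simp: carrier_grigorchuk)
      obtain ss where ss: "wl g = (\<Sum>s\<leftarrow>ss. \<omega> s)"
        "\<And>vs. set vs \<subseteq> S \<Longrightarrow> word_prod grigorchuk_group vs = g \<Longrightarrow> (\<Sum>s\<leftarrow>ss. \<omega> s) \<le> (\<Sum>s\<leftarrow>vs. \<omega> s)"
        using wl_attained[OF g] by blast
      have "wl g \<le> (\<Sum>s\<leftarrow>concat (map k ws). \<omega> s)"
        unfolding ss(1) using k(1) wp[of ws] ws(2) by (intro ss(2)) auto
      also have "\<dots> \<le> M * (\<Sum>l\<leftarrow>ws. 1)" using M by (intro sum_list_concat_le)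
      also have "\<dots> = M * real (length ws)" by (simp add: sum_list_triv)
      also have "\<dots> \<le> M * (2 * real n + 1)"
        using M0 ws(3) count_alternating(1)[OF ws(1)] length_eq_count[of ws]
        by (intro mult_left_mono) auto
      finally show "g \<in> {g \<in> carrier grigorchuk_group. wl g \<le> M * (2 * real n + 1)}"
        using g by simp
    qed
  qed
qed

lemma growth_lower:
  assumes r: "0 < r"
  shows "dominated_from r (\<lambda>n. exp (sqrt n)) (growth grigorchuk_group S \<omega>)"
proof -
  obtain N where N:
    "\<And>x. 0 \<le> x \<Longrightarrow> \<exists>n. real n \<le> real N * (1 + x) \<and> exp (sqrt x) \<le> card (bcd_ball n)"
    using bcd_ball_exp_sqrt by blast
  obtain M where M: "0 < M"
    "\<And>n. bcd_ball n \<subseteq> {g \<in> carrier grigorchuk_group. wl g \<le> M * (2 * real n + 1)}"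
    using bcd_ball_subset_growth_set by blast
  \<comment> \<open>From \<open>2 * n + 1 \<le> (2 * N + 1) + 2 * N * x\<close>; the constant part
    is at most \<open>(2 * N + 1) / r * x\<close> since \<open>x \<ge> r\<close>, and this is where
    the threshold enters.\<close>
  define K where "K = M * ((2 * real N + 1) / r + 2 * real N)"
  have "exp (sqrt x) \<le> growth grigorchuk_group S \<omega> (K * x)" if x: "r \<le> x" for x
  proof -
    obtain n where n: "real n \<le> real N * (1 + x)" "exp (sqrt x) \<le> card (bcd_ball n)"
      using N[of x] r x by auto
    have "(2 * real N + 1) * 1 \<le> (2 * real N + 1) * (x / r)"
      using r x by (intro mult_left_mono) auto
    then have "2 * real N + 1 \<le> (2 * real N + 1) / r * x" by simp
    with n(1) have "2 * real n + 1 \<le> ((2 * real N + 1) / r + 2 * real N) * x"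
      by (simp add: algebra_simps)
    then have "M * (2 * real n + 1) \<le> K * x"
      unfolding K_def mult.assoc using M(1) by (intro mult_left_mono) auto
    then have "bcd_ball n \<subseteq> {g \<in> carrier grigorchuk_group. wl g \<le> K * x}" using M(2)[of n] by force
    then have "card (bcd_ball n) \<le> card {g \<in> carrier grigorchuk_group. wl g \<le> K * x}"
      by (rule card_mono[OF finite_growth_set])
    then show ?thesis using n(2) unfolding growth_def by linarith
  qed
  moreover have "0 \<le> K" using M r by (simp add: K_def)
  ultimately show ?thesis unfolding dominated_from_def by blast
qed

text \<open>Below the least weight only the identity is reached. The bound from
  \<open>card_ball_le\<close> does not tend to 1 at 0, so \<open>growth_upper\<close> treats small
  arguments with this lemma.\<close>

lemma growth_small:
  obtains w where "0 < w" "\<And>n. n < w \<Longrightarrow> growth grigorchuk_group S \<omega> n \<le> 1"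
proof -
  obtain w where w: "w > 0" "\<And>s. s \<in> S \<Longrightarrow> w \<le> \<omega> s"
    using weights_bounded_below[of S \<omega>] finite_S \<omega>_pos by metis
  have "growth grigorchuk_group S \<omega> n \<le> 1" if n: "n < w" for n
  proof -
    have "{g \<in> carrier grigorchuk_group. wl g \<le> n} \<subseteq> {\<one>\<^bsub>grigorchuk_group\<^esub>}"
    proof safe
      fix g assume g: "g \<in> carrier grigorchuk_group" "wl g \<le> n"
      obtain ss where ss: "set ss \<subseteq> S" "word_prod grigorchuk_group ss = g" "wl g = (\<Sum>s\<leftarrow>ss. \<omega> s)"
        using wl_attained[OF g(1)] .
      have "real (length ss) * w < 1 * w"
        using length_le_weight[of S w \<omega> ss, OF w(2) ss(1)] ss(3) g(2) n by linarith
      then have "ss = []" using w by (cases ss) (auto simp: mult_less_cancel_right)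
      then show "g = \<one>\<^bsub>grigorchuk_group\<^esub>" using ss by (simp add: word_prod_def)
    qed
    then have "card {g \<in> carrier grigorchuk_group. wl g \<le> n} \<le> card {\<one>\<^bsub>grigorchuk_group\<^esub>}"
      by (intro card_mono) auto
    then show ?thesis by (simp add: growth_def)
  qed
  with w(1) show thesis by (rule that)
qed

lemma growth_upper:
  "dominated (growth grigorchuk_group S \<omega>) (\<lambda>n. exp (n powr grig_alpha))"
proof -
  obtain w where w: "0 < w" "\<And>n. n < w \<Longrightarrow> growth grigorchuk_group S \<omega> n \<le> 1"
    using growth_small by blast
  obtain M where M: "0 < M" "\<And>n. {g \<in> carrier grigorchuk_group. wl g \<le> n} \<subseteq> ball (M * n)"
    using growth_set_subset_ball by blast
  obtain c where c: "0 < c" "\<And>r. 0 \<le> r \<Longrightarrow> real (card (ball r)) \<le> exp (c * (1 + r powr grig_alpha))"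
    using card_ball_le by blast
  \<comment> \<open>For \<open>n \<ge> w\<close> the summand 1 is at most
    \<open>(n / w) powr \<alpha>\<close>, so \<open>E\<close> collects the whole exponent; its root
    \<open>K\<close> of order \<open>\<alpha>\<close> turns this factor into a rescaling of
    \<open>n\<close>.\<close>
  define E where "E = c * (1 / w powr grig_alpha + M powr grig_alpha)"
  define K where "K = E powr (1 / grig_alpha)"
  have E: "0 < E" using c(1) w(1) M(1) by (simp add: E_def add_pos_pos)
  have K_pow: "(K * n) powr grig_alpha = E * n powr grig_alpha" if "0 \<le> n" for n
    using E that grig_alpha_bounds by (simp add: K_def powr_mult powr_powr)
  have "growth grigorchuk_group S \<omega> n \<le> exp ((K * n) powr grig_alpha)" if n: "0 \<le> n" for n
  proof (cases "n < w")
    case True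
    have "(1::real) \<le> exp ((K * n) powr grig_alpha)" by simp
    then show ?thesis using w(2)[OF True] by linarith
  next
    case False
    have "growth grigorchuk_group S \<omega> n \<le> real (card (ball (M * n)))"
      unfolding growth_def using card_mono[OF finite_ball M(2)[of n]] by simp
    also have "\<dots> \<le> exp (c * (1 + (M * n) powr grig_alpha))" using M(1) n by (intro c(2)) auto
    also have "c * (1 + (M * n) powr grig_alpha) \<le> (K * n) powr grig_alpha"
    proof -
      have "w powr grig_alpha \<le> n powr grig_alpha"
        using False w(1) grig_alpha_bounds by (intro powr_mono2) auto
      then have "1 \<le> 1 / w powr grig_alpha * n powr grig_alpha" using w(1) by (simp add: field_simps)
      then have "1 + (M * n) powr grig_alpha \<le> (1 / w powr grig_alpha + M powr grig_alpha) * n powr grig_alpha"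
        using M(1) n by (simp add: powr_mult distrib_right)
      then show ?thesis unfolding K_pow[OF n] E_def mult.assoc using c(1) by (intro mult_left_mono) auto
    qed
    finally show ?thesis by simp
  qed
  moreover have "0 \<le> K" by (simp add: K_def)
  ultimately show ?thesis unfolding dominated_from_def by blast
qed

end

theorem theorem1p1:
  fixes S :: "(bool list \<Rightarrow> bool list) set"
    and \<omega> :: "(bool list \<Rightarrow> bool list) \<Rightarrow> real"
  assumes "finite S"
    and "monoid_generating_set grigorchuk_group S"
    and "\<And>s. s \<in> S \<Longrightarrow> \<omega> s > 0"
  shows "(\<forall>r>0. dominated_from r (\<lambda>n. exp (sqrt n)) (growth grigorchuk_group S \<omega>)) \<and>
         dominated (growth grigorchuk_group S \<omega>) (\<lambda>n. exp (n powr grig_alpha))"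
proof -
  interpret weighted_generators S \<omega> using assms by unfold_locales
  show ?thesis using growth_lower growth_upper by blast
qed

end
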